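(* Fix a regular language $L\subseteq\Sigma^*$ and an integer constant $k\ge 1$. The predictive membership problem against $L$ modulo $k$-sliced reorderings (given an input run $\sigma\in\Sigma^*$, decide whether there is $\rho\in L$ with $\sigma\rightsquigarrow_s^{(k)}\rho$) can be solved in constant space and linear time, measured in the length of $\sigma$.
   Context: Given finite sets $\mathcal{T}$ (threads) and $\mathcal{X}$ (memory locations), of constant size, let $\Sigma=\{\langle t,op(x)\rangle : t\in\mathcal{T},\ op\in\{\mathtt{w},\mathtt{r}\},\ x\in\mathcal{X}\}$ ($\mathtt{w}$ = write, $\mathtt{r}$ = read). A run is a finite word $\sigma\in\Sigma^*$; the occurrences of letters in it are its events. The reads-from map $\mathsf{rf}_\sigma$ is the partial map sending each read event on a location $x$ to the last write event on $x$ preceding it in $\sigma$, undefined if there is no such write. Reads-from equivalence: $\sigma\equiv_{\mathsf{rf}}\rho$ iff for every thread $t$ the subsequence of events of thread $t$ is the same in $\sigma$ and $\rho$ (same events and same program order; so the $j$-th event of thread $t$ in $\sigma$ is identified with the $j$-th event of thread $t$ in $\rho$), and, under this identification, $\mathsf{rf}_\sigma=\mathsf{rf}_\rho$. $k$-sliced reordering: $\sigma\rightsquigarrow_s^{(k)}\rho$ iff $\sigma\equiv_{\mathsf{rf}}\rho$ and the events of $\sigma$ can be partitioned into $k+1$ disjoint (possibly empty) subsequences $\sigma_1,\dots,\sigma_{k+1}$ of $\sigma$ such that $\rho=\sigma_1\cdot\sigma_2\cdots\sigma_{k+1}$ as sequences of events (identifying, for every thread $t$ and every $j$, the $j$-th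 event of thread $t$ in $\sigma$ with the $j$-th event of thread $t$ in $\rho$). *)

theory Defs
  imports Complex_Main "HOL-Library.Sublist" "HOL-Library.Landau_Symbols"
begin

section \<open>Runs, events and reads-from equivalence\<close>

datatype 'x action = Write 'x | Read 'x

type_synonym ('t, 'x) run = "('t \<times> 'x action) list"

definition alphabet :: "'t set \<Rightarrow> 'x set \<Rightarrow> ('t \<times> 'x action) set" where
  "alphabet \<T> \<X> = \<T> \<times> (Write ` \<X> \<union> Read ` \<X>)"

text \<open>
  An event is named by its thread together with its (0-based) index among the events of that
  thread. Under this naming, the identification of the \<open>j\<close>-th event of thread \<open>t\<close> in one run with
  the \<open>j\<close>-th event of thread \<open>t\<close> in another run is equality.
\<close>

type_synonym 't event = "'t \<times> nat"

definition event :: "('t, 'x) run \<Rightarrow> nat \<Rightarrow> 't event" where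
  "event \<sigma> p = (fst (\<sigma> ! p), card {q. q < p \<and> fst (\<sigma> ! q) = fst (\<sigma> ! p)})"

definition events :: "('t, 'x) run \<Rightarrow> 't event list" where
  "events \<sigma> = map (event \<sigma>) [0..<length \<sigma>]"

definition writes_at :: "('t, 'x) run \<Rightarrow> 'x \<Rightarrow> nat \<Rightarrow> bool" where
  "writes_at \<sigma> x q \<longleftrightarrow> snd (\<sigma> ! q) = Write x"

definition last_write_before :: "('t, 'x) run \<Rightarrow> 'x \<Rightarrow> nat \<Rightarrow> nat option" where
  "last_write_before \<sigma> x p =
     (if \<exists>q<p. writes_at \<sigma> x q then Some (GREATEST q. q < p \<and> writes_at \<sigma> x q) else None)"

definition rf_pos :: "('t, 'x) run \<Rightarrow> nat \<Rightarrow> nat option" where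
  "rf_pos \<sigma> p = (case snd (\<sigma> ! p) of Read x \<Rightarrow> last_write_before \<sigma> x p | Write x \<Rightarrow> None)"

text \<open>
  The map \<open>event \<sigma>\<close> is injective on the positions of \<open>\<sigma>\<close>, so \<open>inv_into\<close> recovers the position
  of an event.
\<close>

definition rf :: "('t, 'x) run \<Rightarrow> 't event \<rightharpoonup> 't event" where
  "rf \<sigma> e =
     (if e \<in> set (events \<sigma>)
      then map_option (event \<sigma>) (rf_pos \<sigma> (inv_into {..<length \<sigma>} (event \<sigma>) e))
      else None)"

definition rf_equiv :: "('t, 'x) run \<Rightarrow> ('t, 'x) run \<Rightarrow> bool" where
  "rf_equiv \<sigma> \<rho> \<longleftrightarrow>
     (\<forall>t. filter (\<lambda>a. fst a = t) \<sigma> = filter (\<lambda>a. fst a = t) \<rho>) \<and> rf \<sigma> = rf \<rho>"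


section \<open>Sliced reorderings and predictive membership\<close>

text \<open>
  Since \<open>events \<sigma>\<close> has no repetitions, each of its subsequences is determined by its set of
  events, and a partition of the events into subsequences is given by disjoint lists \<open>slices ! i\<close>
  covering \<open>set (events \<sigma>)\<close>.
\<close>

definition sliced_reordering :: "nat \<Rightarrow> ('t, 'x) run \<Rightarrow> ('t, 'x) run \<Rightarrow> bool" where
  "sliced_reordering k \<sigma> \<rho> \<longleftrightarrow>
     rf_equiv \<sigma> \<rho> \<and>
     (\<exists>slices. length slices = k + 1 \<and>
        (\<forall>s\<in>set slices. subseq s (events \<sigma>)) \<and>
        (\<forall>i<k+1. \<forall>j<k+1. i \<noteq> j \<longrightarrow> set (slices ! i) \<inter> set (slices ! j) = {}) \<and>
        (\<Union>s\<in>set slices. set s) = set (events \<sigma>) \<and>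
        events \<rho> = concat slices)"

definition predictive_membership :: "('t, 'x) run set \<Rightarrow> nat \<Rightarrow> ('t, 'x) run \<Rightarrow> bool" where
  "predictive_membership L k \<sigma> \<longleftrightarrow> (\<exists>\<rho>\<in>L. sliced_reordering k \<sigma> \<rho>)"


section \<open>Regular languages\<close>

text \<open>Acceptance by a complete deterministic finite automaton with states \<open>{..<n}\<close>.\<close>

definition regular_language :: "'a set \<Rightarrow> 'a list set \<Rightarrow> bool" where
  "regular_language A L \<longleftrightarrow>
     (\<exists>(n::nat) \<delta> q0 F. q0 < n \<and> F \<subseteq> {..<n} \<and> (\<forall>q<n. \<forall>a\<in>A. \<delta> q a < n) \<and>
        L = {w \<in> lists A. foldl \<delta> q0 w \<in> F})"


section \<open>Time- and space-bounded computation\<close>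

text \<open>
  Deterministic Turing machines with a two-way read-only input tape, whose content is delimited by
  end markers, and a two-way infinite work tape. States and work symbols are initial segments of
  the naturals; the blank work symbol is 0. Only the work tape counts towards space.
\<close>

datatype 'a cell = Left_End | Letter 'a | Right_End

datatype move = Left | Stay | Right

record 'a machine =
  num_states :: nat
  num_symbols :: nat
  start :: nat
  accept :: nat
  reject :: nat
  trans :: "nat \<Rightarrow> 'a cell \<Rightarrow> nat \<Rightarrow> nat \<times> nat \<times> move \<times> move"
    \<comment> \<open>state, input cell, work symbol to new state, written symbol, input move, work move\<close>

record config =
  state :: nat
  input_pos :: nat
  work_tape :: "int \<Rightarrow> nat"
  work_pos :: int

definition wf_machine :: "'a set \<Rightarrow> 'a machine \<Rightarrow> bool" where
  "wf_machine A M \<longleftrightarrow>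
     start M < num_states M \<and> accept M < num_states M \<and> reject M < num_states M \<and>
     accept M \<noteq> reject M \<and> 0 < num_symbols M \<and>
     (\<forall>q<num_states M. \<forall>c\<in>{Left_End, Right_End} \<union> Letter ` A. \<forall>s<num_symbols M.
        case trans M q c s of (q', s', _, _) \<Rightarrow> q' < num_states M \<and> s' < num_symbols M)"

text \<open>The input tape has cells \<open>0, \<dots>, length w + 1\<close>; the input head cannot leave them.\<close>

definition input_cell :: "'a list \<Rightarrow> nat \<Rightarrow> 'a cell" where
  "input_cell w i =
     (if i = 0 then Left_End else if i \<le> length w then Letter (w ! (i - 1)) else Right_End)"

fun move_input :: "'a list \<Rightarrow> move \<Rightarrow> nat \<Rightarrow> nat" where
  "move_input w Left i = i - 1"
| "move_input w Stay i = i"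
| "move_input w Right i = min (i + 1) (length w + 1)"

fun move_work :: "move \<Rightarrow> int \<Rightarrow> int" where
  "move_work Left h = h - 1"
| "move_work Stay h = h"
| "move_work Right h = h + 1"

definition halted :: "'a machine \<Rightarrow> config \<Rightarrow> bool" where
  "halted M C \<longleftrightarrow> state C = accept M \<or> state C = reject M"

definition step :: "'a machine \<Rightarrow> 'a list \<Rightarrow> config \<Rightarrow> config" where
  "step M w C =
     (if halted M C then C
      else case trans M (state C) (input_cell w (input_pos C)) (work_tape C (work_pos C)) of
        (q, s, d, e) \<Rightarrow>
          \<lparr>state = q,
           input_pos = move_input w d (input_pos C),
           work_tape = (work_tape C)(work_pos C := s),
           work_pos = move_work e (work_pos C)\<rparr>)"

definition initial :: "'a machine \<Rightarrow> config" where
  "initial M = \<lparr>state = start M, input_pos = 0, work_tape = (\<lambda>_. 0), work_pos = 0\<rparr>"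

definition config_after :: "'a machine \<Rightarrow> 'a list \<Rightarrow> nat \<Rightarrow> config" where
  "config_after M w t = (step M w ^^ t) (initial M)"

definition space_used :: "'a machine \<Rightarrow> 'a list \<Rightarrow> nat \<Rightarrow> nat" where
  "space_used M w t = card ((\<lambda>u. work_pos (config_after M w u)) ` {..t})"

text \<open>
  One machine decides \<open>P\<close> on all words over \<open>A\<close>, visiting at most \<open>S n\<close> work cells and making at
  most \<open>T n\<close> steps on inputs of length \<open>n\<close>.
\<close>

definition solvable_within ::
    "'a set \<Rightarrow> ('a list \<Rightarrow> bool) \<Rightarrow> (nat \<Rightarrow> nat) \<Rightarrow> (nat \<Rightarrow> nat) \<Rightarrow> bool" where
  "solvable_within A P S T \<longleftrightarrow>
     (\<exists>M. wf_machine A M \<and>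
        (\<forall>w\<in>lists A. \<exists>t\<le>T (length w).
           halted M (config_after M w t) \<and>
           (state (config_after M w t) = accept M \<longleftrightarrow> P w) \<and>
           space_used M w t \<le> S (length w)))"

definition solvable_in_constant_space_and_linear_time ::
    "'a set \<Rightarrow> ('a list \<Rightarrow> bool) \<Rightarrow> bool" where
  "solvable_in_constant_space_and_linear_time A P \<longleftrightarrow>
     (\<exists>S T. (\<lambda>n. real (S n)) \<in> O(\<lambda>_. 1) \<and> (\<lambda>n. real (T n)) \<in> O(\<lambda>n. real n) \<and>
        solvable_within A P S T)"

end

theory Submission
  imports Defs "HOL-Library.FuncSet"
begin

text \<open>
  A \<open>k\<close>-sliced reordering of \<open>\<sigma>\<close> amounts to labelling each letter of \<open>\<sigma>\<close> with the number of its
  slice. Program order is kept iff labels do not decrease along any thread. A read with label \<open>i\<close>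
  whose source has label \<open>j\<close> keeps its source iff \<open>j \<le> i\<close>, no earlier write to the same location
  has a label in \<open>(j, i]\<close>, and no later one has a label in \<open>[j, i)\<close>. These conditions, as well as
  membership of the concatenated slices in \<open>L\<close>, can be checked by finite automata reading the
  labelled word from left to right. Hence the runs admitting a good labelling form a projection of
  a regular language, and a finite automaton is a one-pass Turing machine that ignores its work
  tape.
\<close>

section \<open>Finite-state abstractions and regular languages\<close>

text \<open>The kernel of such a map on \<open>lists A\<close> is a right congruence of finite
  index, as in the Myhill-Nerode theorem. The value type is left free, so that states may be pairs,
  sets or functions.\<close>

definition finite_state :: "'a set \<Rightarrow> ('a list \<Rightarrow> 's) \<Rightarrow> bool" where
  "finite_state A \<phi> \<longleftrightarrow>
     finite (\<phi> ` lists A) \<and> (\<exists>g. \<forall>w\<in>lists A. \<forall>a\<in>A. \<phi> (w @ [a]) = g (\<phi> w) a)"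

lemma finite_stateI:
  assumes "\<phi> ` lists A \<subseteq> S" "finite S"
    and "\<And>w a. w \<in> lists A \<Longrightarrow> a \<in> A \<Longrightarrow> \<phi> (w @ [a]) = g (\<phi> w) a"
  shows "finite_state A \<phi>"
  using assms finite_subset unfolding finite_state_def by blast

text \<open>The values taken on \<open>lists A\<close> serve as the states. A bijection
  \<open>h\<close> numbers them, as the definition of regularity asks for states that are naturals,
  and \<open>g\<close> is transported along \<open>h\<close>.\<close>

lemma regular_languageI:
  assumes fs: "finite_state A \<phi>" and acc: "\<And>w. w \<in> lists A \<Longrightarrow> w \<in> L \<longleftrightarrow> acc (\<phi> w)"
    and sub: "L \<subseteq> lists A"
  shows "regular_language A L"
proof -
  define S where "S = \<phi> ` lists A"
  obtain g where fin: "finite S" and g: "\<And>w a. w \<in> lists A \<Longrightarrow> a \<in> A \<Longrightarrow> \<phi> (w @ [a]) = g (\<phi> w) a"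
    using fs unfolding finite_state_def S_def by blast
  obtain h where h: "bij_betw h S {0..<card S}"
    using ex_bij_betw_finite_nat[OF fin] by blast
  define \<delta> where "\<delta> q a = h (g (inv_into S h q) a)" for q a
  have inv: "inv_into S h (h s) = s" if "s \<in> S" for s
    using h that by (simp add: bij_betw_def)
  have hS: "h s < card S" if "s \<in> S" for s
    using h that by (auto simp: bij_betw_def)
  have Sw: "\<phi> w \<in> S" if "w \<in> lists A" for w
    using that by (simp add: S_def)
  have run: "foldl \<delta> (h (\<phi> [])) w = h (\<phi> w)" if "w \<in> lists A" for w
    using that
  proof (induction w rule: rev_induct)
    case (snoc a w)
    then have w: "w \<in> lists A" and a: "a \<in> A" by auto
    then show ?case
      using snoc.IH by (simp add: \<delta>_def inv Sw g)
  qed simp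
  define F where "F = h ` {s \<in> S. acc s}"
  have "\<forall>q<card S. \<forall>a\<in>A. \<delta> q a < card S"
  proof (intro allI impI ballI)
    fix q a assume q: "q < card S" and a: "a \<in> A"
    then obtain s where s: "s \<in> S" "q = h s"
      using h by (force simp: bij_betw_def)
    then obtain w where w: "w \<in> lists A" "s = \<phi> w"
      by (auto simp: S_def)
    have "\<delta> q a = h (\<phi> (w @ [a]))"
      using s w a by (simp add: \<delta>_def inv g)
    then show "\<delta> q a < card S"
      using w a hS Sw by simp
  qed
  moreover have "L = {w \<in> lists A. foldl \<delta> (h (\<phi> [])) w \<in> F}"
  proof -
    have "w \<in> L \<longleftrightarrow> foldl \<delta> (h (\<phi> [])) w \<in> F" if w: "w \<in> lists A" for w
    proof -
      have "h (\<phi> w) \<in> F \<longleftrightarrow> acc (\<phi> w)"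
        using Sw[OF w] inv unfolding F_def by (metis (mono_tags, lifting) image_iff mem_Collect_eq)
      then show ?thesis using run[OF w] acc[OF w] by simp
    qed
    then show ?thesis using sub by blast
  qed
  moreover have "h (\<phi> []) < card S" "F \<subseteq> {..<card S}"
    using hS Sw[of "[]"] unfolding F_def by auto
  ultimately show ?thesis
    unfolding regular_language_def by blast
qed

lemma foldl_in_states:
  assumes "q < n" "\<forall>q<n. \<forall>a\<in>A. \<delta> q a < (n::nat)" "w \<in> lists A"
  shows "foldl \<delta> q w < n"
  using assms(3,1) by (induction w arbitrary: q rule: list.induct) (use assms(2) in auto)

lemma regular_languageE:
  assumes "regular_language A L"
  obtains n :: nat and \<delta> q0 F where "q0 < n" "\<forall>q<n. \<forall>a\<in>A. \<delta> q a < n"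
    "\<forall>w\<in>lists A. w \<in> L \<longleftrightarrow> foldl \<delta> q0 w \<in> F" "L \<subseteq> lists A"
    "finite_state A (foldl \<delta> q0)"
proof -
  obtain n :: nat and \<delta> q0 F where *: "q0 < n" "\<forall>q<n. \<forall>a\<in>A. \<delta> q a < n"
    "L = {w \<in> lists A. foldl \<delta> q0 w \<in> F}"
    using assms unfolding regular_language_def by blast
  have "finite_state A (foldl \<delta> q0)"
    by (rule finite_stateI[where S = "{..<n}" and g = \<delta>])
      (use foldl_in_states[OF *(1,2)] in auto)
  then show ?thesis using * by (intro that[of q0 n \<delta> F]) auto
qed

section \<open>Closure under conjunction, finite quantification and projection\<close>

lemma regular_conj:
  assumes "regular_language A {w \<in> lists A. P w}" "regular_language A {w \<in> lists A. Q w}"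
  shows "regular_language A {w \<in> lists A. P w \<and> Q w}"
proof -
  obtain \<delta>1 and q1 :: nat and F1 where 1:
    "\<forall>w\<in>lists A. w \<in> {w \<in> lists A. P w} \<longleftrightarrow> foldl \<delta>1 q1 w \<in> F1"
    "finite_state A (foldl \<delta>1 q1)"
    by (rule regular_languageE[OF assms(1)], rule that)
  obtain \<delta>2 and q2 :: nat and F2 where 2:
    "\<forall>w\<in>lists A. w \<in> {w \<in> lists A. Q w} \<longleftrightarrow> foldl \<delta>2 q2 w \<in> F2"
    "finite_state A (foldl \<delta>2 q2)"
    by (rule regular_languageE[OF assms(2)], rule that)
  \<comment> \<open>This is the product automaton.\<close>
  have "finite_state A (\<lambda>w. (foldl \<delta>1 q1 w, foldl \<delta>2 q2 w))"
    by (rule finite_stateI[where S = "foldl \<delta>1 q1 ` lists A \<times> foldl \<delta>2 q2 ` lists A"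
          and g = "\<lambda>(p, q) a. (\<delta>1 p a, \<delta>2 q a)"])
      (use 1(2) 2(2) in \<open>auto simp: finite_state_def\<close>)
  then show ?thesis
    by (rule regular_languageI[where acc = "\<lambda>(p, q). p \<in> F1 \<and> q \<in> F2"])
      (use 1(1) 2(1) in auto)
qed

text \<open>Iterated products handle the conjunctions over all threads and over all
  locations.\<close>

lemma regular_ball:
  assumes "finite I" "\<And>i. i \<in> I \<Longrightarrow> regular_language A {w \<in> lists A. P i w}"
  shows "regular_language A {w \<in> lists A. \<forall>i\<in>I. P i w}"
  using assms
proof (induction I rule: finite_induct)
  case empty
  have "finite_state A (\<lambda>_. ())"
    by (rule finite_stateI[where S = UNIV and g = "\<lambda>_ _. ()"]) auto
  then show ?case
    by (rule regular_languageI[where acc = "\<lambda>_. True"]) auto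
next
  case (insert i I)
  then show ?case
    using regular_conj[of A "P i" "\<lambda>w. \<forall>i\<in>I. P i w"] by simp
qed

text \<open>Erasing the second components leaves a nondeterministic automaton that guesses them. It
  is determinised by the subset construction: \<open>\<psi> w\<close> is the set of states reachable
  over all labellings of \<open>w\<close>.\<close>

lemma regular_projection:
  assumes "regular_language (A \<times> I) U"
  shows "regular_language A (map fst ` U)"
proof -
  obtain n :: nat and \<delta> q0 F where *: "q0 < n" "\<forall>q<n. \<forall>a\<in>A \<times> I. \<delta> q a < n"
    "\<forall>w\<in>lists (A \<times> I). w \<in> U \<longleftrightarrow> foldl \<delta> q0 w \<in> F" "U \<subseteq> lists (A \<times> I)"
    by (rule regular_languageE[OF assms], rule that)
  define \<psi> where "\<psi> w = {foldl \<delta> q0 u | u. u \<in> lists (A \<times> I) \<and> map fst u = w}" for w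
  have "finite_state A \<psi>"
  proof (rule finite_stateI)
    show "\<psi> ` lists A \<subseteq> Pow {..<n}"
      using foldl_in_states[OF *(1,2)] by (auto simp: \<psi>_def)
    show "finite (Pow {..<n})" by simp
    fix w a assume "w \<in> lists A" "a \<in> A"
    then show "\<psi> (w @ [a]) = (\<lambda>Q a. {\<delta> q (a, i) | q i. q \<in> Q \<and> i \<in> I}) (\<psi> w) a"
    proof (intro set_eqI iffI)
      fix q assume "q \<in> \<psi> (w @ [a])"
      then obtain u where u: "u \<in> lists (A \<times> I)" "map fst u = w @ [a]" "q = foldl \<delta> q0 u"
        unfolding \<psi>_def by blast
      then obtain v b where v: "u = v @ [b]"
        by (cases u rule: rev_cases) auto
      then show "q \<in> (\<lambda>Q a. {\<delta> q (a, i) | q i. q \<in> Q \<and> i \<in> I}) (\<psi> w) a"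
        using u unfolding \<psi>_def by (cases b) auto
    next
      fix q assume "q \<in> (\<lambda>Q a. {\<delta> q (a, i) | q i. q \<in> Q \<and> i \<in> I}) (\<psi> w) a"
      then obtain u i where u: "u \<in> lists (A \<times> I)" "map fst u = w" "q = \<delta> (foldl \<delta> q0 u) (a, i)" "i \<in> I"
        unfolding \<psi>_def by blast
      then show "q \<in> \<psi> (w @ [a])"
        using \<open>a \<in> A\<close> unfolding \<psi>_def by (intro CollectI exI[of _ "u @ [(a, i)]"]) auto
    qed
  qed
  then show ?thesis
  proof (rule regular_languageI[where acc = "\<lambda>Q. Q \<inter> F \<noteq> {}"])
    show "w \<in> map fst ` U \<longleftrightarrow> \<psi> w \<inter> F \<noteq> {}" if "w \<in> lists A" for w
      using *(3,4) unfolding \<psi>_def by blast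
    show "map fst ` U \<subseteq> lists A"
      using *(4) by fastforce
  qed
qed


section \<open>Finite automata as Turing machines\<close>

text \<open>States below \<open>n\<close> simulate the automaton, while \<open>n\<close> and
  \<open>n + 1\<close> are the halting states. The only work symbol is the blank, and the work head
  stays put. The last branch gives the halting states the closure that \<open>wf_machine\<close>
  demands.\<close>

definition dfa_machine :: "nat \<Rightarrow> (nat \<Rightarrow> 'a \<Rightarrow> nat) \<Rightarrow> nat \<Rightarrow> nat set \<Rightarrow> 'a machine" where
  "dfa_machine n \<delta> q0 F =
     \<lparr>num_states = n + 2, num_symbols = 1, start = q0, accept = n, reject = n + 1,
      trans = (\<lambda>q c s. if q < n then
          (case c of Left_End \<Rightarrow> (q, 0, Right, Stay)
           | Letter a \<Rightarrow> (\<delta> q a, 0, Right, Stay)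
           | Right_End \<Rightarrow> (if q \<in> F then n else n + 1, 0, Stay, Stay))
        else (q, 0, Stay, Stay))\<rparr>"

text \<open>The input is scanned once in \<open>length w + 2\<close> steps: one to leave the left
  marker, one per letter and one at the right marker.\<close>

lemma regular_imp_solvable:
  assumes "regular_language A L" and P: "\<And>w. w \<in> lists A \<Longrightarrow> w \<in> L \<longleftrightarrow> P w"
  shows "solvable_in_constant_space_and_linear_time A P"
proof -
  obtain n :: nat and \<delta> q0 F where *: "q0 < n" "\<forall>q<n. \<forall>a\<in>A. \<delta> q a < n"
    "\<forall>w\<in>lists A. w \<in> L \<longleftrightarrow> foldl \<delta> q0 w \<in> F"
    by (rule regular_languageE[OF assms(1)], rule that)
  define M where "M = dfa_machine n \<delta> q0 F"
  note M = M_def dfa_machine_def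
  have wf: "wf_machine A M"
  proof -
    have "\<delta> q a < Suc (Suc n)" if "q < n" "a \<in> A" for q a
      using *(2) that less_SucI by blast
    then show ?thesis
      using *(1) by (auto simp: wf_machine_def M)
  qed
  \<comment> \<open>The first step only leaves the left marker, so \<open>t\<close> letters have
    been read after \<open>Suc t\<close> steps.\<close>
  have run: "config_after M w (Suc t) =
      \<lparr>state = foldl \<delta> q0 (take t w), input_pos = Suc t, work_tape = (\<lambda>_. 0), work_pos = 0\<rparr>"
    if w: "w \<in> lists A" and "t \<le> length w" for w t
    using \<open>t \<le> length w\<close>
  proof (induction t)
    case 0
    show ?case
      using *(1) by (simp add: config_after_def initial_def step_def halted_def M input_cell_def
          fun_upd_idem)
  next
    case (Suc t)
    have "take t w \<in> lists A"
      using w by (meson in_lists_conv_set in_set_takeD)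
    then have q: "foldl \<delta> q0 (take t w) < n"
      using foldl_in_states[OF *(1,2)] by blast
    have "config_after M w (Suc (Suc t)) = step M w (config_after M w (Suc t))"
      by (simp add: config_after_def)
    also have "\<dots> = step M w \<lparr>state = foldl \<delta> q0 (take t w), input_pos = Suc t,
        work_tape = (\<lambda>_. 0), work_pos = 0\<rparr>"
      using Suc by simp
    also have "\<dots> = \<lparr>state = foldl \<delta> q0 (take (Suc t) w), input_pos = Suc (Suc t),
        work_tape = (\<lambda>_. 0), work_pos = 0\<rparr>"
      using q Suc.prems
      by (simp add: step_def halted_def M input_cell_def take_Suc_conv_app_nth fun_upd_idem)
    finally show ?case .
  qed
  have halt: "config_after M w (Suc (Suc (length w))) =
      \<lparr>state = (if foldl \<delta> q0 w \<in> F then n else n + 1), input_pos = Suc (length w),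
       work_tape = (\<lambda>_. 0), work_pos = 0\<rparr>" if w: "w \<in> lists A" for w
  proof -
    have q: "foldl \<delta> q0 w < n"
      using foldl_in_states[OF *(1,2) w] .
    have "config_after M w (Suc (Suc (length w))) = step M w (config_after M w (Suc (length w)))"
      by (simp add: config_after_def)
    also have "\<dots> = step M w \<lparr>state = foldl \<delta> q0 w, input_pos = Suc (length w),
        work_tape = (\<lambda>_. 0), work_pos = 0\<rparr>"
      using run[OF w, of "length w"] by simp
    finally show ?thesis
      using q by (simp add: step_def halted_def M input_cell_def fun_upd_idem)
  qed
  have pos: "work_pos (config_after M w u) = 0" if "w \<in> lists A" "u \<le> length w + 2" for w u
  proof (cases u)
    case (Suc t)
    then show ?thesis
      using run[OF that(1), of t] halt[OF that(1)] that(2) by (cases "t \<le> length w") (auto simp: le_Suc_eq)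
  qed (simp add: config_after_def initial_def)
  have "solvable_within A P (\<lambda>_. 1) (\<lambda>n. n + 2)"
    unfolding solvable_within_def
  proof (intro exI[of _ M] conjI ballI wf)
    fix w assume w: "w \<in> lists A"
    have "(\<lambda>u. work_pos (config_after M w u)) ` {..Suc (Suc (length w))} \<subseteq> {0}"
      using pos[OF w] by auto
    then have "space_used M w (Suc (Suc (length w))) \<le> 1"
      unfolding space_used_def using card_mono[of "{0::int}"] by fastforce
    then show "\<exists>t\<le>length w + 2. halted M (config_after M w t) \<and>
        (state (config_after M w t) = accept M \<longleftrightarrow> P w) \<and> space_used M w t \<le> 1"
      using halt[OF w] bspec[OF *(3) w] P[OF w]
      by (intro exI[of _ "Suc (Suc (length w))"]) (simp add: halted_def M)
  qed
  \<comment> \<open>For \<open>n \<ge> 1\<close> one has \<open>n + 2 \<le> 3 * n\<close>, whence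
    the constant 3.\<close>
  moreover have "(\<lambda>n. real (n + 2)) \<in> O(\<lambda>n. real n)"
    by (rule bigoI[of _ 3]) (use eventually_ge_at_top[of 1] in eventually_elim, simp)
  ultimately show ?thesis
    unfolding solvable_in_constant_space_and_linear_time_def
    by (intro exI[of _ "\<lambda>_. 1"] exI[of _ "\<lambda>n. n + 2"]) simp
qed


section \<open>Events under a permutation of positions\<close>

lemma fst_event [simp]: "fst (event \<sigma> p) = fst (\<sigma> ! p)"
  by (simp add: event_def)

text \<open>All same-thread predecessors of \<open>p\<close> are predecessors of \<open>q\<close>,
  and \<open>p\<close> itself is a further one.\<close>

lemma event_mono:
  assumes "p < q" "fst (\<sigma> ! p) = fst (\<sigma> ! q)"
  shows "snd (event \<sigma> p) < snd (event \<sigma> q)"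
proof -
  have "card {r. r < p \<and> fst (\<sigma> ! r) = fst (\<sigma> ! p)} < card {r. r < q \<and> fst (\<sigma> ! r) = fst (\<sigma> ! q)}"
    using assms by (intro psubset_card_mono) auto
  then show ?thesis by (simp add: event_def)
qed

lemma inj_event: "inj (event \<sigma>)"
  by (rule injI) (metis event_mono fst_event linorder_neq_iff less_irrefl)

lemma event_less_iff:
  assumes "fst (\<sigma> ! p) = fst (\<sigma> ! q)"
  shows "snd (event \<sigma> p) < snd (event \<sigma> q) \<longleftrightarrow> p < q"
  by (metis assms event_mono less_asym' linorder_neqE_nat)

lemma set_events: "set (events \<sigma>) = event \<sigma> ` {..<length \<sigma>}"
  by (auto simp: events_def)

lemma distinct_events: "distinct (events \<sigma>)"
  by (simp add: events_def distinct_map inj_on_subset[OF inj_event])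

lemma length_events [simp]: "length (events \<sigma>) = length \<sigma>"
  by (simp add: events_def)

lemma nth_events: "p < length \<sigma> \<Longrightarrow> events \<sigma> ! p = event \<sigma> p"
  by (simp add: events_def)

lemma rf_event:
  assumes "p < length \<sigma>"
  shows "rf \<sigma> (event \<sigma> p) = map_option (event \<sigma>) (rf_pos \<sigma> p)"
proof -
  have "inv_into {..<length \<sigma>} (event \<sigma>) (event \<sigma> p) = p"
    using assms inj_event by (intro inv_into_f_f) (auto simp: inj_on_def inj_def)
  then show ?thesis
    using assms by (simp add: rf_def set_events)
qed

text \<open>The letters of the thread before position \<open>p\<close> are counted by the index of
  the event. Hence the name of an event finds its letter in the thread projection, and runs with
  equal projections carry equal letters at equally named events.\<close>

lemma nth_thread_events:
  assumes "p < length \<sigma>"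
  shows "filter (\<lambda>a. fst a = fst (\<sigma> ! p)) \<sigma> ! snd (event \<sigma> p) = \<sigma> ! p"
proof -
  define Q where "Q a \<longleftrightarrow> fst a = fst (\<sigma> ! p)" for a :: "'a \<times> 'b action"
  have "filter Q \<sigma> = filter Q (take p \<sigma>) @ \<sigma> ! p # filter Q (drop (Suc p) \<sigma>)"
    by (subst id_take_nth_drop[OF assms]) (simp add: Q_def)
  moreover have "length (filter Q (take p \<sigma>)) = snd (event \<sigma> p)"
  proof -
    have "{i. i < length (take p \<sigma>) \<and> Q (take p \<sigma> ! i)} = {q. q < p \<and> fst (\<sigma> ! q) = fst (\<sigma> ! p)}"
      using assms by (auto simp: Q_def)
    then show ?thesis
      by (simp add: length_filter_conv_card event_def)
  qed
  ultimately show ?thesis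
    unfolding Q_def by (metis nth_append_length)
qed

lemma last_write_before_Some:
  "last_write_before \<sigma> x p = Some q \<longleftrightarrow>
     q < p \<and> writes_at \<sigma> x q \<and> (\<forall>r<p. writes_at \<sigma> x r \<longrightarrow> r \<le> q)"
proof -
  let ?P = "\<lambda>q. q < p \<and> writes_at \<sigma> x q"
  have max: "?P (Greatest ?P) \<and> (\<forall>r. ?P r \<longrightarrow> r \<le> Greatest ?P)" if "?P r" for r
    using GreatestI_nat[of ?P r p] Greatest_le_nat[of ?P _ p] that by auto
  show ?thesis
  proof
    assume "last_write_before \<sigma> x p = Some q"
    then show "q < p \<and> writes_at \<sigma> x q \<and> (\<forall>r<p. writes_at \<sigma> x r \<longrightarrow> r \<le> q)"
      using max unfolding last_write_before_def by (auto split: if_splits)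
  next
    assume *: "q < p \<and> writes_at \<sigma> x q \<and> (\<forall>r<p. writes_at \<sigma> x r \<longrightarrow> r \<le> q)"
    then have "Greatest ?P = q"
      by (intro Greatest_equality) auto
    then show "last_write_before \<sigma> x p = Some q"
      using * unfolding last_write_before_def by auto
  qed
qed

lemma last_write_before_None:
  "last_write_before \<sigma> x p = None \<longleftrightarrow> (\<forall>q<p. \<not> writes_at \<sigma> x q)"
  unfolding last_write_before_def by auto

lemma rf_pos_less: "rf_pos \<sigma> p = Some q \<Longrightarrow> q < p"
  by (auto simp: rf_pos_def last_write_before_Some split: action.splits)

section \<open>Permutations of positions that preserve program order\<close>

lemma nth_permutation_less:
  assumes "set \<pi> = {..<length \<sigma>}" "a < length \<pi>"
  shows "\<pi> ! a < length \<sigma>"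
  using assms nth_mem by fastforce

text \<open>Since \<open>\<pi>\<close> keeps the order within each thread, it maps the same-thread
  predecessors of \<open>a\<close> in the permuted run bijectively onto those of
  \<open>\<pi> ! a\<close> in \<open>\<sigma>\<close>. Counting both sets gives equal
  indices.\<close>

lemma event_permuted:
  assumes dist: "distinct \<pi>" and set: "set \<pi> = {..<length \<sigma>}"
    and ord: "sorted_wrt (\<lambda>p q. fst (\<sigma> ! p) = fst (\<sigma> ! q) \<longrightarrow> p < q) \<pi>"
    and a: "a < length \<pi>"
  shows "event (map ((!) \<sigma>) \<pi>) a = event \<sigma> (\<pi> ! a)"
proof -
  let ?\<rho> = "map ((!) \<sigma>) \<pi>"
  have mono: "\<pi> ! b < \<pi> ! c" if "b < c" "c < length \<pi>" "fst (\<sigma> ! (\<pi> ! b)) = fst (\<sigma> ! (\<pi> ! c))" for b c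
    using ord that by (auto simp: sorted_wrt_iff_nth_less)
  have "bij_betw ((!) \<pi>) {b. b < a \<and> fst (?\<rho> ! b) = fst (?\<rho> ! a)}
      {q. q < \<pi> ! a \<and> fst (\<sigma> ! q) = fst (\<sigma> ! (\<pi> ! a))}"
    unfolding bij_betw_def
  proof
    show "inj_on ((!) \<pi>) {b. b < a \<and> fst (?\<rho> ! b) = fst (?\<rho> ! a)}"
      using dist a by (auto simp: inj_on_def nth_eq_iff_index_eq)
    show "(!) \<pi> ` {b. b < a \<and> fst (?\<rho> ! b) = fst (?\<rho> ! a)} =
        {q. q < \<pi> ! a \<and> fst (\<sigma> ! q) = fst (\<sigma> ! (\<pi> ! a))}" (is "?l = ?r")
    proof
      show "?l \<subseteq> ?r" using mono a by auto
      show "?r \<subseteq> ?l"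
      proof
        fix q assume q: "q \<in> ?r"
        then have "q \<in> set \<pi>"
          using nth_permutation_less[OF set a] set by auto
        then obtain b where b: "b < length \<pi>" "q = \<pi> ! b"
          by (auto simp: in_set_conv_nth)
        then have "b < a"
          using mono[of a b] q by (metis (mono_tags, lifting) less_asym' linorder_neqE_nat mem_Collect_eq)
        then show "q \<in> ?l" using b q a by auto
      qed
    qed
  qed
  then show ?thesis
    using a by (simp add: event_def bij_betw_same_card)
qed

text \<open>The positions of thread \<open>t\<close>, taken in the order of \<open>\<pi>\<close>,
  form a sorted list without repetitions, and such a list is determined by its set.\<close>

lemma filter_thread_permuted:
  assumes dist: "distinct \<pi>" and set: "set \<pi> = {..<length \<sigma>}"
    and ord: "sorted_wrt (\<lambda>p q. fst (\<sigma> ! p) = fst (\<sigma> ! q) \<longrightarrow> p < q) \<pi>"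
  shows "filter (\<lambda>a. fst a = t) (map ((!) \<sigma>) \<pi>) = filter (\<lambda>a. fst a = t) \<sigma>"
proof -
  let ?Q = "\<lambda>p. fst (\<sigma> ! p) = t"
  have "sorted_wrt (\<lambda>p q. fst (\<sigma> ! p) = fst (\<sigma> ! q) \<longrightarrow> p < q) (filter ?Q \<pi>)"
    using ord by (rule sorted_wrt_filter)
  then have "sorted (filter ?Q \<pi>)"
    by (rule sorted_wrt_mono_rel[rotated]) auto
  then have "filter ?Q \<pi> = filter ?Q [0..<length \<sigma>]"
    using dist set by (intro sorted_distinct_set_unique) (auto simp: sorted_wrt_filter)
  then have "filter (\<lambda>a. fst a = t) (map ((!) \<sigma>) \<pi>) =
      filter (\<lambda>a. fst a = t) (map ((!) \<sigma>) [0..<length \<sigma>])"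
    by (simp add: filter_map o_def)
  then show ?thesis by (simp add: map_nth)
qed

text \<open>Corresponding positions have the same event names, and \<open>event \<sigma>\<close> is
  injective. Equality of the maps on events therefore reduces to an equation between positions, with
  \<open>\<pi>\<close> translating those of the permuted run into those of
  \<open>\<sigma>\<close>.\<close>

lemma rf_permuted_iff:
  assumes dist: "distinct \<pi>" and set: "set \<pi> = {..<length \<sigma>}"
    and ord: "sorted_wrt (\<lambda>p q. fst (\<sigma> ! p) = fst (\<sigma> ! q) \<longrightarrow> p < q) \<pi>"
  shows "rf \<sigma> = rf (map ((!) \<sigma>) \<pi>) \<longleftrightarrow>
    (\<forall>a<length \<pi>. map_option ((!) \<pi>) (rf_pos (map ((!) \<sigma>) \<pi>) a) = rf_pos \<sigma> (\<pi> ! a))"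
proof -
  let ?\<rho> = "map ((!) \<sigma>) \<pi>"
  note ev = event_permuted[OF dist set ord]
  have surj: "{..<length \<sigma>} = (!) \<pi> ` {..<length \<pi>}"
    unfolding set[symmetric] by (auto simp: in_set_conv_nth)
  have evs: "set (events ?\<rho>) = set (events \<sigma>)"
    using ev by (simp add: set_events surj image_image)
  have "map_option (event ?\<rho>) (rf_pos ?\<rho> a) =
      map_option (event \<sigma>) (map_option ((!) \<pi>) (rf_pos ?\<rho> a))" if "a < length \<pi>" for a
    using that ev rf_pos_less[of ?\<rho> a] by (cases "rf_pos ?\<rho> a") auto
  then have rho: "rf ?\<rho> (event \<sigma> (\<pi> ! a)) =
      map_option (event \<sigma>) (map_option ((!) \<pi>) (rf_pos ?\<rho> a))" if "a < length \<pi>" for a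
    using that rf_event[of a ?\<rho>] ev by simp
  have "rf \<sigma> = rf ?\<rho> \<longleftrightarrow> (\<forall>e\<in>set (events \<sigma>). rf \<sigma> e = rf ?\<rho> e)"
    using evs by (auto simp: rf_def fun_eq_iff)
  also have "\<dots> \<longleftrightarrow> (\<forall>a<length \<pi>. rf \<sigma> (event \<sigma> (\<pi> ! a)) = rf ?\<rho> (event \<sigma> (\<pi> ! a)))"
    unfolding set_events surj by auto
  also have "\<dots> \<longleftrightarrow> (\<forall>a<length \<pi>. map_option (event \<sigma>) (rf_pos \<sigma> (\<pi> ! a)) =
      map_option (event \<sigma>) (map_option ((!) \<pi>) (rf_pos ?\<rho> a)))"
    using rho rf_event[OF nth_permutation_less[OF set]] by simp
  also have "\<dots> \<longleftrightarrow> (\<forall>a<length \<pi>. map_option ((!) \<pi>) (rf_pos ?\<rho> a) = rf_pos \<sigma> (\<pi> ! a))"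
    using option.inj_map[OF inj_event[of \<sigma>]] by (metis injD)
  finally show ?thesis .
qed


section \<open>Slicings as labellings\<close>

text \<open>The order in which the concatenated slices list the positions: lexicographic in label
  and position.\<close>

definition slice_before :: "(nat \<Rightarrow> nat) \<Rightarrow> nat \<Rightarrow> nat \<Rightarrow> bool" where
  "slice_before lab p q \<longleftrightarrow> lab p < lab q \<or> lab p = lab q \<and> p < q"

text \<open>The permutation performed by the reordering: entry \<open>a\<close> is the position in
  the original run of the letter that ends up at place \<open>a\<close>. Labels start at 0, so the
  bound \<open>k\<close> allows \<open>k + 1\<close> slices.\<close>

definition slice_order :: "nat \<Rightarrow> nat \<Rightarrow> (nat \<Rightarrow> nat) \<Rightarrow> nat list" where
  "slice_order k n lab = concat (map (\<lambda>i. filter (\<lambda>p. lab p = i) [0..<n]) [0..<Suc k])"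

lemma set_slice_order:
  "\<forall>p<n. lab p \<le> k \<Longrightarrow> set (slice_order k n lab) = {..<n}"
  by (force simp: slice_order_def)

lemma sorted_slice_order: "sorted_wrt (slice_before lab) (slice_order k n lab)"
proof -
  have "sorted_wrt (slice_before lab) (concat (map (\<lambda>i. filter (\<lambda>p. lab p = i) [0..<n]) [0..<m]))" for m
  proof (induction m)
    case (Suc m)
    have "sorted_wrt (slice_before lab) (filter (\<lambda>p. lab p = m) [0..<n])"
      using sorted_wrt_filter[OF sorted_wrt_upt[of 0 n], of "\<lambda>p. lab p = m"]
      by (rule sorted_wrt_mono_rel[rotated]) (auto simp: slice_before_def)
    moreover have "slice_before lab p q"
      if "p \<in> set (concat (map (\<lambda>i. filter (\<lambda>p. lab p = i) [0..<n]) [0..<m]))"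
        "q \<in> set (filter (\<lambda>p. lab p = m) [0..<n])" for p q
      using that by (auto simp: slice_before_def)
    ultimately show ?case
      using Suc by (simp add: sorted_wrt_append)
  qed simp
  then show ?thesis unfolding slice_order_def .
qed

lemma distinct_slice_order: "distinct (slice_order k n lab)"
  using sorted_slice_order[of lab k n] unfolding sorted_wrt_iff_nth_less distinct_conv_nth
  by (metis linorder_neqE_nat order_less_irrefl slice_before_def)

text \<open>The list is sorted by a relation that is irreflexive and asymmetric, so the relation
  between two entries decides which comes first. This replaces places in the reordering by labels
  and original positions.\<close>

lemma nth_slice_order_less_iff:
  assumes "a < length (slice_order k n lab)" "b < length (slice_order k n lab)"
  shows "a < b \<longleftrightarrow> slice_before lab (slice_order k n lab ! a) (slice_order k n lab ! b)"
proof -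
  note * = sorted_slice_order[of lab k n, unfolded sorted_wrt_iff_nth_less, rule_format]
  have asym: "\<not> slice_before lab q p" if "slice_before lab p q" for p q
    using that by (auto simp: slice_before_def)
  have irr: "\<not> slice_before lab p p" for p
    by (auto simp: slice_before_def)
  show ?thesis
    using *[of a b] *[of b a] asym irr assms by (metis linorder_neqE_nat)
qed

definition threads_ordered :: "('t, 'x) run \<Rightarrow> (nat \<Rightarrow> nat) \<Rightarrow> bool" where
  "threads_ordered \<sigma> lab \<longleftrightarrow>
     (\<forall>q<length \<sigma>. \<forall>p<q. fst (\<sigma> ! p) = fst (\<sigma> ! q) \<longrightarrow> lab p \<le> lab q)"

text \<open>It expresses, in positions of \<open>\<sigma>\<close> only, that the last write to
  \<open>x\<close> before \<open>p\<close> is the same before and after the reordering.\<close>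

definition same_source :: "('t, 'x) run \<Rightarrow> (nat \<Rightarrow> nat) \<Rightarrow> 'x \<Rightarrow> nat \<Rightarrow> bool" where
  "same_source \<sigma> lab x p \<longleftrightarrow>
     (case last_write_before \<sigma> x p of
        None \<Rightarrow> \<forall>r<length \<sigma>. writes_at \<sigma> x r \<longrightarrow> \<not> slice_before lab r p
      | Some q \<Rightarrow> slice_before lab q p \<and>
          (\<forall>r<length \<sigma>. writes_at \<sigma> x r \<and> slice_before lab r p \<longrightarrow> r = q \<or> slice_before lab r q))"

definition same_sources :: "('t, 'x) run \<Rightarrow> (nat \<Rightarrow> nat) \<Rightarrow> 'x \<Rightarrow> bool" where
  "same_sources \<sigma> lab x \<longleftrightarrow>
     (\<forall>p<length \<sigma>. snd (\<sigma> ! p) = Read x \<longrightarrow> same_source \<sigma> lab x p)"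

text \<open>Within a slice the original order survives, so two events are swapped exactly if the
  earlier one has the larger label.\<close>

lemma threads_ordered_iff:
  assumes lab: "\<forall>p<length \<sigma>. lab p \<le> k"
  shows "threads_ordered \<sigma> lab \<longleftrightarrow>
    sorted_wrt (\<lambda>p q. fst (\<sigma> ! p) = fst (\<sigma> ! q) \<longrightarrow> p < q) (slice_order k (length \<sigma>) lab)"
    (is "_ \<longleftrightarrow> sorted_wrt ?R ?\<pi>")
proof
  assume *: "threads_ordered \<sigma> lab"
  have "?R p q" if "p \<in> set ?\<pi>" "q \<in> set ?\<pi>" "slice_before lab p q" for p q
  proof (intro impI, rule ccontr)
    assume eq: "fst (\<sigma> ! p) = fst (\<sigma> ! q)" and "\<not> p < q"
    then have "lab p < lab q" "q < p"
      using that(3) by (auto simp: slice_before_def) (metis less_irrefl linorder_neqE_nat)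
    moreover have "p < length \<sigma>"
      using that(1) set_slice_order[OF lab] by simp
    ultimately show False
      using * eq unfolding threads_ordered_def by (metis leD)
  qed
  then show "sorted_wrt ?R ?\<pi>"
    by (rule sorted_wrt_mono_rel[OF _ sorted_slice_order])
next
  assume *: "sorted_wrt ?R ?\<pi>"
  show "threads_ordered \<sigma> lab"
    unfolding threads_ordered_def
  proof (intro allI impI)
    fix p q assume pq: "q < length \<sigma>" "p < q" "fst (\<sigma> ! p) = fst (\<sigma> ! q)"
    then have "p \<in> set ?\<pi>" "q \<in> set ?\<pi>"
      using set_slice_order[OF lab] by auto
    then obtain a b where ab: "a < length ?\<pi>" "?\<pi> ! a = p" "b < length ?\<pi>" "?\<pi> ! b = q"
      unfolding in_set_conv_nth by blast
    then have "\<not> b < a"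
      using *[unfolded sorted_wrt_iff_nth_less, rule_format, of b a] pq by auto
    moreover have "a \<noteq> b" using ab pq by auto
    ultimately have "slice_before lab p q"
      using nth_slice_order_less_iff[OF ab(1,3)] ab by auto
    then show "lab p \<le> lab q" by (auto simp: slice_before_def)
  qed
qed

text \<open>As \<open>\<pi>\<close> enumerates all positions once, quantifiers over positions become
  quantifiers over places, and \<open>b < c\<close> for places becomes \<open>slice_before\<close>
  for the entries there.\<close>

lemma same_source_iff:
  assumes lab: "\<forall>p<length \<sigma>. lab p \<le> k"
    and \<pi>_def: "\<pi> = slice_order k (length \<sigma>) lab" and a: "a < length \<pi>"
  shows "map_option ((!) \<pi>) (last_write_before (map ((!) \<sigma>) \<pi>) x a) = last_write_before \<sigma> x (\<pi> ! a)
    \<longleftrightarrow> same_source \<sigma> lab x (\<pi> ! a)"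
proof -
  let ?\<rho> = "map ((!) \<sigma>) \<pi>"
  have less: "b < c \<longleftrightarrow> slice_before lab (\<pi> ! b) (\<pi> ! c)" if "b < length \<pi>" "c < length \<pi>" for b c
    using that nth_slice_order_less_iff unfolding \<pi>_def by blast
  have set: "set \<pi> = {..<length \<sigma>}"
    using set_slice_order[OF lab] \<pi>_def by simp
  have wr: "writes_at ?\<rho> x b \<longleftrightarrow> writes_at \<sigma> x (\<pi> ! b)" if "b < length \<pi>" for b
    using that by (simp add: writes_at_def)
  have all: "(\<forall>r<length \<sigma>. Q r) \<longleftrightarrow> (\<forall>b<length \<pi>. Q (\<pi> ! b))" for Q
    using set by (metis in_set_conv_nth lessThan_iff)
  have inj: "\<pi> ! b = \<pi> ! c \<longleftrightarrow> b = c" if "b < length \<pi>" "c < length \<pi>" for b c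
    using that distinct_slice_order nth_eq_iff_index_eq unfolding \<pi>_def by blast
  show ?thesis
  proof (cases "last_write_before \<sigma> x (\<pi> ! a)")
    case None
    have "(\<forall>b<a. \<not> writes_at ?\<rho> x b) \<longleftrightarrow>
        (\<forall>b<length \<pi>. writes_at \<sigma> x (\<pi> ! b) \<longrightarrow> \<not> slice_before lab (\<pi> ! b) (\<pi> ! a))"
      using a less wr by (meson less_trans)
    then have "last_write_before ?\<rho> x a = None \<longleftrightarrow> same_source \<sigma> lab x (\<pi> ! a)"
      unfolding last_write_before_None same_source_def None all by simp
    then show ?thesis
      using None by simp
  next
    case (Some q)
    then have "q < length \<sigma>"
      using nth_permutation_less[OF set a] by (simp add: last_write_before_Some)
    then obtain c where c: "c < length \<pi>" "q = \<pi> ! c"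
      using set by (metis in_set_conv_nth lessThan_iff)
    have "map_option ((!) \<pi>) (last_write_before ?\<rho> x a) = Some q \<longleftrightarrow> last_write_before ?\<rho> x a = Some c"
      using c a inj by (auto simp: last_write_before_Some)
    also have "\<dots> \<longleftrightarrow> c < a \<and> writes_at ?\<rho> x c \<and> (\<forall>b<length \<pi>. b < a \<and> writes_at ?\<rho> x b \<longrightarrow> b = c \<or> b < c)"
    proof -
      have "r < length \<pi>" if "r < a" for r
        using that a by simp
      then show ?thesis
        by (auto simp: last_write_before_Some le_less)
    qed
    also have "\<dots> \<longleftrightarrow> c < a \<and> (\<forall>b<length \<pi>. b < a \<and> writes_at \<sigma> x (\<pi> ! b) \<longrightarrow> b = c \<or> b < c)"
      using Some c wr by (auto simp: last_write_before_Some)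
    also have "\<dots> \<longleftrightarrow> same_source \<sigma> lab x (\<pi> ! a)"
      using Some c a less inj by (auto simp: same_source_def all)
    finally show ?thesis using Some by simp
  qed
qed

lemma rf_slice_order_iff:
  assumes lab: "\<forall>p<length \<sigma>. lab p \<le> k" and ord: "threads_ordered \<sigma> lab"
    and \<pi>_def: "\<pi> = slice_order k (length \<sigma>) lab"
  shows "rf \<sigma> = rf (map ((!) \<sigma>) \<pi>) \<longleftrightarrow> (\<forall>x. same_sources \<sigma> lab x)"
proof -
  have set: "set \<pi> = {..<length \<sigma>}" and dist: "distinct \<pi>"
    using set_slice_order[OF lab] distinct_slice_order \<pi>_def by auto
  have all: "(\<forall>p<length \<sigma>. Q p) \<longleftrightarrow> (\<forall>a<length \<pi>. Q (\<pi> ! a))" for Q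
    using set by (metis in_set_conv_nth lessThan_iff)
  have "rf \<sigma> = rf (map ((!) \<sigma>) \<pi>) \<longleftrightarrow>
      (\<forall>a<length \<pi>. map_option ((!) \<pi>) (rf_pos (map ((!) \<sigma>) \<pi>) a) = rf_pos \<sigma> (\<pi> ! a))"
    using rf_permuted_iff[OF dist set] ord threads_ordered_iff[OF lab] \<pi>_def by blast
  also have "\<dots> \<longleftrightarrow> (\<forall>a<length \<pi>. \<forall>x. snd (\<sigma> ! (\<pi> ! a)) = Read x \<longrightarrow> same_source \<sigma> lab x (\<pi> ! a))"
  proof (intro all_cong1 imp_cong refl)
    fix a assume a: "a < length \<pi>"
    then show "map_option ((!) \<pi>) (rf_pos (map ((!) \<sigma>) \<pi>) a) = rf_pos \<sigma> (\<pi> ! a) \<longleftrightarrow>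
        (\<forall>x. snd (\<sigma> ! (\<pi> ! a)) = Read x \<longrightarrow> same_source \<sigma> lab x (\<pi> ! a))"
      using same_source_iff[OF lab \<pi>_def a]
      by (cases "snd (\<sigma> ! (\<pi> ! a))") (auto simp: rf_pos_def)
  qed
  also have "\<dots> \<longleftrightarrow> (\<forall>x. same_sources \<sigma> lab x)"
    unfolding same_sources_def all by blast
  finally show ?thesis .
qed

text \<open>Without repetitions, membership alone decides which entries are kept. This turns a
  slice, given as a subsequence, into a filter.\<close>

lemma subseq_distinct_eq_filter:
  assumes "subseq xs ys" "distinct ys"
  shows "xs = filter (\<lambda>y. y \<in> set xs) ys"
  using assms
proof (induction rule: list_emb.induct)
  case (list_emb_Cons xs ys y)
  moreover have "y \<notin> set xs"
    using list_emb_Cons by (auto dest: list_emb_set)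
  ultimately show ?case by simp
next
  case (list_emb_Cons2 x y xs ys)
  then have "filter (\<lambda>z. z = y \<or> z \<in> set xs) ys = filter (\<lambda>z. z \<in> set xs) ys"
    by (intro filter_cong) auto
  then show ?case using list_emb_Cons2 by auto
qed simp

text \<open>From slices to labels, each position gets the index of the slice containing its event,
  unique by disjointness. Conversely, the slices are the label classes in the order of the
  labels.\<close>

lemma sliced_reordering_iff:
  "sliced_reordering k \<sigma> \<rho> \<longleftrightarrow>
     (\<exists>lab. (\<forall>p<length \<sigma>. lab p \<le> k) \<and> threads_ordered \<sigma> lab \<and> (\<forall>x. same_sources \<sigma> lab x) \<and>
        \<rho> = map ((!) \<sigma>) (slice_order k (length \<sigma>) lab))"
proof
  assume sr: "sliced_reordering k \<sigma> \<rho>"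
  then obtain slices where len: "length slices = k + 1"
    and sub: "\<forall>s\<in>set slices. subseq s (events \<sigma>)"
    and disj: "\<forall>i<k+1. \<forall>j<k+1. i \<noteq> j \<longrightarrow> set (slices ! i) \<inter> set (slices ! j) = {}"
    and cover: "(\<Union>s\<in>set slices. set s) = set (events \<sigma>)"
    and conc: "events \<rho> = concat slices"
    unfolding sliced_reordering_def by blast
  have fil: "\<And>t. filter (\<lambda>a. fst a = t) \<sigma> = filter (\<lambda>a. fst a = t) \<rho>" and rf: "rf \<sigma> = rf \<rho>"
    using sr unfolding sliced_reordering_def rf_equiv_def by blast+
  have "\<exists>i\<le>k. event \<sigma> p \<in> set (slices ! i)" if "p < length \<sigma>" for p
  proof -
    have "event \<sigma> p \<in> (\<Union>s\<in>set slices. set s)"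
      using that cover by (simp add: set_events)
    then obtain s where "s \<in> set slices" "event \<sigma> p \<in> set s" by blast
    then show ?thesis
      using len by (metis Suc_eq_plus1 in_set_conv_nth less_Suc_eq_le)
  qed
  then obtain lab where lab: "\<And>p. p < length \<sigma> \<Longrightarrow> lab p \<le> k \<and> event \<sigma> p \<in> set (slices ! lab p)"
    by metis
  define \<pi> where "\<pi> = slice_order k (length \<sigma>) lab"
  have labk: "\<forall>p<length \<sigma>. lab p \<le> k" using lab by blast
  have slice: "slices ! i = map (event \<sigma>) (filter (\<lambda>p. lab p = i) [0..<length \<sigma>])" if "i \<le> k" for i
  proof -
    have "slices ! i = filter (\<lambda>e. e \<in> set (slices ! i)) (events \<sigma>)"
      using sub len that by (intro subseq_distinct_eq_filter distinct_events) auto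
    also have "\<dots> = map (event \<sigma>) (filter (\<lambda>p. event \<sigma> p \<in> set (slices ! i)) [0..<length \<sigma>])"
      by (simp add: events_def filter_map o_def)
    also have "filter (\<lambda>p. event \<sigma> p \<in> set (slices ! i)) [0..<length \<sigma>] =
        filter (\<lambda>p. lab p = i) [0..<length \<sigma>]"
    proof (intro filter_cong refl)
      fix p assume "p \<in> set [0..<length \<sigma>]"
      then show "event \<sigma> p \<in> set (slices ! i) \<longleftrightarrow> lab p = i"
        using lab[of p] disj[rule_format, of i "lab p"] that by auto
    qed
    finally show ?thesis .
  qed
  have "slices = map (\<lambda>i. map (event \<sigma>) (filter (\<lambda>p. lab p = i) [0..<length \<sigma>])) [0..<Suc k]"
    using len slice by (intro nth_equalityI) (auto simp del: upt_Suc)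
  then have ev: "events \<rho> = map (event \<sigma>) \<pi>"
    unfolding conc \<pi>_def slice_order_def map_concat by (simp del: upt_Suc add: o_def)
  then have len\<rho>: "length \<rho> = length \<pi>"
    by (metis length_events length_map)
  have ev_nth: "event \<rho> a = event \<sigma> (\<pi> ! a)" if "a < length \<pi>" for a
    using that ev nth_events[of a \<rho>] len\<rho> by simp
  have thr: "fst (\<rho> ! a) = fst (\<sigma> ! (\<pi> ! a))" if "a < length \<pi>" for a
    using ev_nth[OF that] by (metis fst_event)
  have set: "set \<pi> = {..<length \<sigma>}"
    using set_slice_order[OF labk] \<pi>_def by simp
  \<comment> \<open>Event names do not record actions; these are recovered from the equal thread
    projections.\<close>
  have "\<rho> ! a = \<sigma> ! (\<pi> ! a)" if a: "a < length \<pi>" for a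
    using nth_thread_events[of a \<rho>] nth_thread_events[of "\<pi> ! a" \<sigma>] a len\<rho> ev_nth[OF a] thr[OF a] fil
      nth_permutation_less[OF set a] by simp
  then have \<rho>: "\<rho> = map ((!) \<sigma>) \<pi>"
    using len\<rho> by (intro nth_equalityI) auto
  have ord: "threads_ordered \<sigma> lab"
    \<comment> \<open>Indices within a thread increase along \<open>\<rho>\<close>. As
      \<open>\<rho>\<close> and \<open>\<sigma>\<close> share the event names, the positions in
      \<open>\<sigma>\<close> increase too.\<close>
    unfolding threads_ordered_iff[OF labk] \<pi>_def[symmetric] sorted_wrt_iff_nth_less
  proof (intro allI impI)
    fix a b assume ab: "a < b" "b < length \<pi>" "fst (\<sigma> ! (\<pi> ! a)) = fst (\<sigma> ! (\<pi> ! b))"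
    then have "snd (event \<rho> a) < snd (event \<rho> b)"
      using thr by (intro event_mono) auto
    then show "\<pi> ! a < \<pi> ! b"
      using ev_nth ab event_less_iff[OF ab(3)] by auto
  qed
  then have "\<forall>x. same_sources \<sigma> lab x"
    using rf_slice_order_iff[OF labk ord \<pi>_def] rf \<rho> by simp
  then show "\<exists>lab. (\<forall>p<length \<sigma>. lab p \<le> k) \<and> threads_ordered \<sigma> lab \<and> (\<forall>x. same_sources \<sigma> lab x) \<and>
        \<rho> = map ((!) \<sigma>) (slice_order k (length \<sigma>) lab)"
    using labk ord \<rho> \<pi>_def by blast
next
  assume "\<exists>lab. (\<forall>p<length \<sigma>. lab p \<le> k) \<and> threads_ordered \<sigma> lab \<and> (\<forall>x. same_sources \<sigma> lab x) \<and>
        \<rho> = map ((!) \<sigma>) (slice_order k (length \<sigma>) lab)"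
  then obtain lab where labk: "\<forall>p<length \<sigma>. lab p \<le> k" and ord: "threads_ordered \<sigma> lab"
    and src: "\<forall>x. same_sources \<sigma> lab x"
    and \<rho>: "\<rho> = map ((!) \<sigma>) (slice_order k (length \<sigma>) lab)"
    by blast
  define \<pi> where "\<pi> = slice_order k (length \<sigma>) lab"
  have set: "set \<pi> = {..<length \<sigma>}" and dist: "distinct \<pi>"
    using set_slice_order[OF labk] distinct_slice_order \<pi>_def by auto
  have ord': "sorted_wrt (\<lambda>p q. fst (\<sigma> ! p) = fst (\<sigma> ! q) \<longrightarrow> p < q) \<pi>"
    using ord threads_ordered_iff[OF labk] \<pi>_def by blast
  have "rf_equiv \<sigma> \<rho>"
    unfolding rf_equiv_def \<rho> \<pi>_def[symmetric]
    using filter_thread_permuted[OF dist set ord'] rf_slice_order_iff[OF labk ord \<pi>_def] src by simp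
  \<comment> \<open>Labels that do not occur yield empty slices, so there are always
    \<open>k + 1\<close> of them.\<close>
  moreover define slices where
    "slices = map (\<lambda>i. map (event \<sigma>) (filter (\<lambda>p. lab p = i) [0..<length \<sigma>])) [0..<Suc k]"
  have len: "length slices = k + 1"
    by (simp add: slices_def)
  have ev: "events \<rho> = map (event \<sigma>) \<pi>"
    using event_permuted[OF dist set ord'] unfolding \<rho> \<pi>_def[symmetric]
    by (intro nth_equalityI) (auto simp: nth_events)
  then have conc: "events \<rho> = concat slices"
    unfolding slices_def \<pi>_def slice_order_def map_concat by (simp del: upt_Suc add: o_def)
  have nth: "slices ! i = map (event \<sigma>) (filter (\<lambda>p. lab p = i) [0..<length \<sigma>])" if "i < k + 1" for i
    using that by (simp add: slices_def del: upt_Suc)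
  have sub: "\<forall>s\<in>set slices. subseq s (events \<sigma>)"
    unfolding slices_def events_def by (auto intro!: subseq_map simp del: upt_Suc)
  have disj: "set (slices ! i) \<inter> set (slices ! j) = {}" if "i < k + 1" "j < k + 1" "i \<noteq> j" for i j
    using that nth inj_event[of \<sigma>] by (auto dest: injD)
  have cover: "(\<Union>s\<in>set slices. set s) = set (events \<sigma>)"
    using arg_cong[OF conc, of set] ev set by (simp add: set_events)
  ultimately show "sliced_reordering k \<sigma> \<rho>"
    unfolding sliced_reordering_def using len sub disj cover conc by blast
qed


section \<open>Recognising good labellings\<close>

lemma finite_state_foldl:
  assumes "finite S" "s0 \<in> S" "\<And>s a. s \<in> S \<Longrightarrow> a \<in> A \<Longrightarrow> g s a \<in> S"
  shows "finite_state A (foldl g s0)"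
proof -
  have "foldl g s0 w \<in> S" if "w \<in> lists A" for w
    using that assms(2) by (induction w arbitrary: s0 rule: list.induct) (use assms(3) in auto)
  then show ?thesis
    by (intro finite_stateI[where S = S and g = g] assms) auto
qed

abbreviation label :: "('a \<times> nat) list \<Rightarrow> nat \<Rightarrow> nat" where
  "label u p \<equiv> snd (u ! p)"

abbreviation slice :: "('a \<times> nat) list \<Rightarrow> nat \<Rightarrow> 'a list" where
  "slice u i \<equiv> map fst (filter (\<lambda>z. snd z = i) u)"

section \<open>Automaton for program order\<close>

definition thread_ordered :: "'t \<Rightarrow> (('t \<times> 'x action) \<times> nat) list \<Rightarrow> bool" where
  "thread_ordered t u \<longleftrightarrow> (\<forall>q<length u. \<forall>p<q. fst (fst (u ! p)) = t \<and> fst (fst (u ! q)) = t \<longrightarrow>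
     label u p \<le> label u q)"

lemma regular_thread_ordered:
  "regular_language (A \<times> {..k}) {u \<in> lists (A \<times> {..k}). thread_ordered t u}"
proof -
  \<comment> \<open>The state holds the set of labels already seen on thread \<open>t\<close> and a
    flag. There are finitely many states because labels are at most \<open>k\<close>.\<close>
  define g :: "nat set \<times> bool \<Rightarrow> ('a \<times> 'b action) \<times> nat \<Rightarrow> nat set \<times> bool" where
    "g = (\<lambda>(S, ok) b. if fst (fst b) = t then (insert (snd b) S, ok \<and> (\<forall>j\<in>S. j \<le> snd b)) else (S, ok))"
  have "finite_state (A \<times> {..k}) (foldl g ({}, True))"
    by (rule finite_state_foldl[where S = "Pow {..k} \<times> UNIV"]) (auto simp: g_def split: if_splits)
  moreover have flag: "thread_ordered t u \<longleftrightarrow> snd (foldl g ({}, True) u)" for u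
  proof -
    have "foldl g ({}, True) (take m u) =
        ({label u p | p. p < m \<and> fst (fst (u ! p)) = t},
         \<forall>q<m. \<forall>p<q. fst (fst (u ! p)) = t \<and> fst (fst (u ! q)) = t \<longrightarrow> label u p \<le> label u q)"
      if "m \<le> length u" for m
      using that
    proof (induction m)
      case (Suc m)
      then have IH: "foldl g ({}, True) (take (Suc m) u) = g
        ({label u p | p. p < m \<and> fst (fst (u ! p)) = t},
         \<forall>q<m. \<forall>p<q. fst (fst (u ! p)) = t \<and> fst (fst (u ! q)) = t \<longrightarrow> label u p \<le> label u q) (u ! m)"
        by (simp add: take_Suc_conv_app_nth)
      show ?case
        unfolding IH by (auto simp: g_def less_Suc_eq)
    qed simp
    from this[of "length u"] show ?thesis
      by (simp add: thread_ordered_def)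
  qed
  ultimately show ?thesis
    by (intro regular_languageI[where acc = snd]) (auto simp: flag)
qed

section \<open>Automaton for the sources of reads\<close>

text \<open>A read without a source counts as reading from an initial write in slice \<open>0\<close>.\<close>

definition source_label :: "('t, 'x) run \<Rightarrow> (nat \<Rightarrow> nat) \<Rightarrow> 'x \<Rightarrow> nat \<Rightarrow> nat" where
  "source_label \<sigma> lab x p = (case last_write_before \<sigma> x p of None \<Rightarrow> 0 | Some q \<Rightarrow> lab q)"

text \<open>By this recursion one register suffices to know the label of the current source.\<close>

lemma source_label_Suc:
  "source_label \<sigma> lab x (Suc p) = (if writes_at \<sigma> x p then lab p else source_label \<sigma> lab x p)"
proof (cases "writes_at \<sigma> x p")
  case True
  then have "last_write_before \<sigma> x (Suc p) = Some p"
    by (simp add: last_write_before_Some less_Suc_eq_le)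
  then show ?thesis using True by (simp add: source_label_def)
next
  case False
  have "last_write_before \<sigma> x (Suc p) = last_write_before \<sigma> x p"
  proof (rule option.expand)
    show "(last_write_before \<sigma> x (Suc p) = None) = (last_write_before \<sigma> x p = None)"
      using False by (auto simp only: last_write_before_None less_Suc_eq)
  next
    assume "last_write_before \<sigma> x (Suc p) \<noteq> None" "last_write_before \<sigma> x p \<noteq> None"
    then obtain q where q: "last_write_before \<sigma> x p = Some q" by auto
    then have "last_write_before \<sigma> x (Suc p) = Some q"
      using False unfolding last_write_before_Some by (auto simp: less_Suc_eq)
    then show "the (last_write_before \<sigma> x (Suc p)) = the (last_write_before \<sigma> x p)"
      using q by simp
  qed
  then show ?thesis using False by (simp add: source_label_def)
qed

text \<open>Here \<open>m\<close> is the length of the prefix inspected so far. Let the source have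
  label \<open>j\<close> and the read label \<open>i\<close>. An earlier write labelled
  \<open>j\<close> stays before the source, but one labelled \<open>i > j\<close> lands between
  source and read. A later write labelled \<open>i\<close> stays behind the read, but one labelled
  \<open>j < i\<close> lands in between. Hence the two half-open intervals.\<close>

definition undisturbed :: "('t, 'x) run \<Rightarrow> (nat \<Rightarrow> nat) \<Rightarrow> 'x \<Rightarrow> nat \<Rightarrow> nat \<Rightarrow> bool" where
  "undisturbed \<sigma> lab x m p \<longleftrightarrow>
     source_label \<sigma> lab x p \<le> lab p \<and>
     (\<forall>r<p. writes_at \<sigma> x r \<longrightarrow> lab r \<notin> {source_label \<sigma> lab x p<..lab p}) \<and>
     (\<forall>r<m. p < r \<longrightarrow> writes_at \<sigma> x r \<longrightarrow> lab r \<notin> {source_label \<sigma> lab x p..<lab p})"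

text \<open>The read is no write, so every other write lies strictly before or strictly after it. If
  there is no source, all writes come later, and with default label 0 the last interval contains
  exactly the labels below that of the read.\<close>

lemma same_source_iff_undisturbed:
  assumes p: "p < length \<sigma>" "snd (\<sigma> ! p) = Read x"
  shows "same_source \<sigma> lab x p \<longleftrightarrow> undisturbed \<sigma> lab x (length \<sigma>) p"
proof -
  have not: "\<not> writes_at \<sigma> x p" using p by (simp add: writes_at_def)
  show ?thesis
  proof (cases "last_write_before \<sigma> x p")
    case None
    then have src: "source_label \<sigma> lab x p = 0"
      by (simp add: source_label_def)
    have no: "p < r" if "writes_at \<sigma> x r" for r
      using not None that by (metis last_write_before_None linorder_neqE_nat)
    have "same_source \<sigma> lab x p \<longleftrightarrow> (\<forall>r<length \<sigma>. writes_at \<sigma> x r \<longrightarrow> \<not> slice_before lab r p)"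
      using None by (simp add: same_source_def)
    also have "\<dots> \<longleftrightarrow> undisturbed \<sigma> lab x (length \<sigma>) p"
      using no by (fastforce simp: undisturbed_def src slice_before_def)
    finally show ?thesis .
  next
    case (Some q)
    then have src: "source_label \<sigma> lab x p = lab q"
      by (simp add: source_label_def)
    have q: "q < p" "writes_at \<sigma> x q" and last: "\<And>r. r < p \<Longrightarrow> writes_at \<sigma> x r \<Longrightarrow> r \<le> q"
      using Some by (auto simp: last_write_before_Some)
    have same: "same_source \<sigma> lab x p \<longleftrightarrow> slice_before lab q p \<and>
        (\<forall>r<length \<sigma>. writes_at \<sigma> x r \<and> slice_before lab r p \<longrightarrow> r = q \<or> slice_before lab r q)"
      using Some by (simp add: same_source_def)
    show ?thesis
    proof
      assume *: "same_source \<sigma> lab x p"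
      then have le: "lab q \<le> lab p"
        unfolding same by (auto simp: slice_before_def)
      have "lab r \<notin> {lab q<..lab p}" if "r < p" "writes_at \<sigma> x r" for r
        using * that p(1) unfolding same slice_before_def by (auto dest!: spec[of _ r])
      moreover have "lab r \<notin> {lab q..<lab p}" if "r < length \<sigma>" "p < r" "writes_at \<sigma> x r" for r
        using * that q(1) unfolding same slice_before_def by (auto dest!: spec[of _ r])
      ultimately show "undisturbed \<sigma> lab x (length \<sigma>) p"
        using le by (simp add: undisturbed_def src)
    next
      assume *: "undisturbed \<sigma> lab x (length \<sigma>) p"
      have "r = q \<or> slice_before lab r q"
        if r: "r < length \<sigma>" "writes_at \<sigma> x r" "slice_before lab r p" for r
      proof (cases "r < p")
        case True
        then have "r \<le> q" "lab r \<le> lab q"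
          using last r * unfolding undisturbed_def src slice_before_def by auto
        then show ?thesis by (auto simp: slice_before_def)
      next
        case False
        then have "p < r" using not r(2) by (metis linorder_neqE_nat)
        then show ?thesis
          using r * unfolding undisturbed_def src slice_before_def by auto
      qed
      moreover have "slice_before lab q p"
        using * q(1) by (auto simp: undisturbed_def src slice_before_def)
      ultimately show "same_source \<sigma> lab x p"
        unfolding same by blast
    qed
  qed
qed

text \<open>
  The state consists of the label of the last write to \<open>x\<close>, the labels of all writes to \<open>x\<close>, the
  labels forbidden to later writes to \<open>x\<close> by earlier reads, and a flag.
\<close>

definition source_step ::
    "'x \<Rightarrow> nat \<times> nat set \<times> nat set \<times> bool \<Rightarrow> ('t \<times> 'x action) \<times> nat \<Rightarrow>
      nat \<times> nat set \<times> nat set \<times> bool" where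
  "source_step x = (\<lambda>(j, S, B, ok) (a, i).
     if snd a = Write x then (i, insert i S, B, ok \<and> i \<notin> B)
     else if snd a = Read x then (j, S, B \<union> {j..<i}, ok \<and> j \<le> i \<and> S \<inter> {j<..i} = {})
     else (j, S, B, ok))"

text \<open>Whether a read tolerates the earlier writes is settled when it is met. Its demands on
  later writes are merged into one set of forbidden labels, against which each new write is
  checked.\<close>

lemma foldl_source_step:
  assumes "m \<le> length u"
  defines "\<sigma> \<equiv> map fst u"
  defines "lab \<equiv> label u"
  shows "foldl (source_step x) (0, {}, {}, True) (take m u) =
    (source_label \<sigma> lab x m, {lab r | r. r < m \<and> writes_at \<sigma> x r},
     {l. \<exists>p<m. snd (\<sigma> ! p) = Read x \<and> l \<in> {source_label \<sigma> lab x p..<lab p}},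
     \<forall>p<m. snd (\<sigma> ! p) = Read x \<longrightarrow> undisturbed \<sigma> lab x m p)"
  using assms(1)
proof (induction m)
  case 0
  have "last_write_before \<sigma> x 0 = None" by (simp only: last_write_before_None) simp
  then show ?case by (simp add: source_label_def)
next
  case (Suc m)
  let ?W = "{lab r | r. r < m \<and> writes_at \<sigma> x r}"
  let ?B = "{l. \<exists>p<m. snd (\<sigma> ! p) = Read x \<and> l \<in> {source_label \<sigma> lab x p..<lab p}}"
  let ?ok = "\<lambda>m. \<forall>p<m. snd (\<sigma> ! p) = Read x \<longrightarrow> undisturbed \<sigma> lab x m p"
  have um: "u ! m = (\<sigma> ! m, lab m)"
    using Suc.prems by (simp add: \<sigma>_def lab_def)
  have IH: "foldl (source_step x) (0, {}, {}, True) (take (Suc m) u) =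
      source_step x (source_label \<sigma> lab x m, ?W, ?B, ?ok m) (\<sigma> ! m, lab m)"
    using Suc by (simp add: take_Suc_conv_app_nth um)
  \<comment> \<open>For a read already seen, letter \<open>m\<close> can only act as a later
    write.\<close>
  have und: "undisturbed \<sigma> lab x (Suc m) p \<longleftrightarrow> undisturbed \<sigma> lab x m p \<and>
      (writes_at \<sigma> x m \<longrightarrow> lab m \<notin> {source_label \<sigma> lab x p..<lab p})" if "p < m" for p
    using that unfolding undisturbed_def by (auto simp: less_Suc_eq)
  \<comment> \<open>For a read at \<open>m\<close> itself, the prefix contains no later write
    yet.\<close>
  have und': "undisturbed \<sigma> lab x (Suc m) m \<longleftrightarrow>
      source_label \<sigma> lab x m \<le> lab m \<and> ?W \<inter> {source_label \<sigma> lab x m<..lab m} = {}"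
    unfolding undisturbed_def by (fastforce simp: less_Suc_eq)
  have ok: "?ok (Suc m) \<longleftrightarrow> ?ok m \<and> (writes_at \<sigma> x m \<longrightarrow> lab m \<notin> ?B) \<and>
      (snd (\<sigma> ! m) = Read x \<longrightarrow>
        source_label \<sigma> lab x m \<le> lab m \<and> ?W \<inter> {source_label \<sigma> lab x m<..lab m} = {})"
    using und und' by (auto simp: less_Suc_eq)
  show ?case
    unfolding IH ok source_label_Suc
    by (auto simp: source_step_def writes_at_def less_Suc_eq)
qed

lemma regular_same_sources:
  "regular_language (A \<times> {..k})
     {u \<in> lists (A \<times> {..k}). same_sources (map fst u) (label u) x}"
proof -
  have "finite_state (A \<times> {..k}) (foldl (source_step x) (0, {}, {}, True))"
    by (rule finite_state_foldl[where S = "{..k} \<times> Pow {..k} \<times> Pow {..k} \<times> UNIV"])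
      (auto simp: source_step_def)
  moreover have flag: "same_sources (map fst u) (label u) x \<longleftrightarrow>
      snd (snd (snd (foldl (source_step x) (0, {}, {}, True) u)))" for u
    using foldl_source_step[of "length u" u x] same_source_iff_undisturbed[of _ "map fst u" x "label u"]
    by (auto simp: same_sources_def)
  ultimately show ?thesis
    by (intro regular_languageI[where acc = "\<lambda>s. snd (snd (snd s))"]) (auto simp: flag)
qed

section \<open>Automaton for membership of the concatenated slices\<close>

lemma foldl_concat_map:
  "foldl \<delta> q (concat (map f is)) = foldl (\<lambda>q i. foldl \<delta> q (f i)) q is"
  by (induction "is" arbitrary: q) auto

text \<open>The automaton tracks the state transformation induced by each slice.\<close>

lemma regular_concat_slices:
  assumes "regular_language A L"
  shows "regular_language (A \<times> {..k})
    {u \<in> lists (A \<times> {..k}). concat (map (slice u) [0..<Suc k]) \<in> L}"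
proof -
  obtain n :: nat and \<delta> q0 F where *: "q0 < n" "\<forall>q<n. \<forall>a\<in>A. \<delta> q a < n"
    "\<forall>w\<in>lists A. w \<in> L \<longleftrightarrow> foldl \<delta> q0 w \<in> F"
    by (rule regular_languageE[OF assms], rule that)
  have slice: "slice u i \<in> lists A" if "u \<in> lists (A \<times> {..k})" for u i
    using that by fastforce
  \<comment> \<open>The slices arrive interleaved, so the state in which a slice will start is
    unknown while it is read; all start states are followed at once. \<open>restrict\<close> makes
    the space of such functions finite.\<close>
  define D where "D u = restrict (\<lambda>(i, q). foldl \<delta> q (slice u i)) ({..k} \<times> {..<n})" for u
  have "finite_state (A \<times> {..k}) D"
  proof (rule finite_stateI)
    show "D ` lists (A \<times> {..k}) \<subseteq> ({..k} \<times> {..<n}) \<rightarrow>\<^sub>E {..<n}"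
    proof (rule image_subsetI)
      fix u assume "u \<in> lists (A \<times> {..k})"
      then have "foldl \<delta> q (slice u i) < n" if "q < n" for q i
        using foldl_in_states[OF that *(2) slice] by blast
      then show "D u \<in> ({..k} \<times> {..<n}) \<rightarrow>\<^sub>E {..<n}"
        unfolding D_def by (intro restrict_PiE_iff[THEN iffD2]) auto
    qed
    show "finite (({..k} \<times> {..<n}) \<rightarrow>\<^sub>E {..<n})"
      by (intro finite_PiE) auto
    show "D (u @ [b]) = (\<lambda>d b. restrict (\<lambda>(i, q). if snd b = i then \<delta> (d (i, q)) (fst b) else d (i, q))
        ({..k} \<times> {..<n})) (D u) b" for u b
      by (auto simp: D_def fun_eq_iff restrict_def)
  qed
  then show ?thesis
  proof (rule regular_languageI[where acc = "\<lambda>d. foldl (\<lambda>q i. d (i, q)) q0 [0..<Suc k] \<in> F"])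
    fix u assume u: "u \<in> lists (A \<times> {..k})"
    \<comment> \<open>Composing the transformations in slice order simulates the run on the
      concatenation. The bound \<open>n\<close> is carried along since \<open>D u\<close> is
      meaningful only on states below \<open>n\<close>.\<close>
    have "foldl (\<lambda>q i. D u (i, q)) q0 [0..<m] = foldl (\<lambda>q i. foldl \<delta> q (slice u i)) q0 [0..<m] \<and>
        foldl (\<lambda>q i. D u (i, q)) q0 [0..<m] < n" if "m \<le> Suc k" for m
      using that
    proof (induction m)
      case (Suc m)
      then show ?case
        using foldl_in_states[OF _ *(2) slice[OF u]] by (simp add: D_def)
    qed (use *(1) in simp)
    from this[of "Suc k"]
    have "foldl (\<lambda>q i. D u (i, q)) q0 [0..<Suc k] = foldl \<delta> q0 (concat (map (slice u) [0..<Suc k]))"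
      unfolding foldl_concat_map by blast
    moreover have "concat (map (slice u) [0..<Suc k]) \<in> lists A"
      using slice[OF u] unfolding in_lists_conv_set set_concat set_map[of "slice u"] by blast
    ultimately show "u \<in> {u \<in> lists (A \<times> {..k}). concat (map (slice u) [0..<Suc k]) \<in> L} \<longleftrightarrow>
        foldl (\<lambda>q i. D u (i, q)) q0 [0..<Suc k] \<in> F"
      using *(3) u by simp
  qed auto
qed

section \<open>Predictive membership in terms of labelled words\<close>

lemma concat_slices:
  "map ((!) (map fst u)) (slice_order k (length u) (label u)) = concat (map (slice u) [0..<Suc k])"
proof -
  have "map ((!) (map fst u)) (filter (\<lambda>p. label u p = i) [0..<length u]) = slice u i" for i
  proof -
    have "slice u i = map fst (filter (\<lambda>z. snd z = i) (map ((!) u) [0..<length u]))"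
      by (simp add: map_nth)
    then show ?thesis by (simp add: filter_map o_def)
  qed
  then show ?thesis
    by (simp add: slice_order_def map_concat o_def del: upt_Suc)
qed

lemma threads_ordered_cong:
  assumes "\<And>p. p < length \<sigma> \<Longrightarrow> lab p = lab' p"
  shows "threads_ordered \<sigma> lab \<longleftrightarrow> threads_ordered \<sigma> lab'"
  using assms by (auto simp: threads_ordered_def)

text \<open>A label function is defined on all naturals, whereas a labelled word only fixes labels
  at its positions. All positions that are compared lie inside the run, so the two may be
  exchanged.\<close>

lemma same_sources_cong:
  assumes "\<And>p. p < length \<sigma> \<Longrightarrow> lab p = lab' p"
  shows "same_sources \<sigma> lab x \<longleftrightarrow> same_sources \<sigma> lab' x"
proof -
  have before: "slice_before lab p q \<longleftrightarrow> slice_before lab' p q" if "p < length \<sigma>" "q < length \<sigma>" for p q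
    using assms that by (simp add: slice_before_def)
  have "same_source \<sigma> lab x p \<longleftrightarrow> same_source \<sigma> lab' x p" if "p < length \<sigma>" for p
  proof (cases "last_write_before \<sigma> x p")
    case (Some q)
    then have "q < length \<sigma>"
      using that by (simp add: last_write_before_Some)
    then show ?thesis
      using before that Some by (auto simp: same_source_def)
  qed (use before that in \<open>auto simp: same_source_def\<close>)
  then show ?thesis by (simp add: same_sources_def)
qed

lemma predictive_membership_iff:
  assumes \<sigma>: "\<sigma> \<in> lists A"
  shows "predictive_membership L k \<sigma> \<longleftrightarrow>
    (\<exists>u\<in>lists (A \<times> {..k}). map fst u = \<sigma> \<and> threads_ordered (map fst u) (label u) \<and>
      (\<forall>x. same_sources (map fst u) (label u) x) \<and> concat (map (slice u) [0..<Suc k]) \<in> L)"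
    (is "_ \<longleftrightarrow> ?rhs")
proof
  assume "predictive_membership L k \<sigma>"
  then obtain lab where lab: "\<forall>p<length \<sigma>. lab p \<le> k" "threads_ordered \<sigma> lab"
    "\<forall>x. same_sources \<sigma> lab x" "map ((!) \<sigma>) (slice_order k (length \<sigma>) lab) \<in> L"
    unfolding predictive_membership_def sliced_reordering_iff by blast
  define u where "u = map (\<lambda>p. (\<sigma> ! p, lab p)) [0..<length \<sigma>]"
  have fst: "map fst u = \<sigma>"
    by (simp add: u_def o_def map_nth)
  have len: "length u = length \<sigma>"
    by (simp add: u_def)
  have eq: "label u p = lab p" if "p < length \<sigma>" for p
    using that by (simp add: u_def)
  have "u \<in> lists (A \<times> {..k})"
    using \<sigma> lab(1) by (auto simp: u_def in_lists_conv_set)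
  moreover have "slice_order k (length \<sigma>) (label u) = slice_order k (length \<sigma>) lab"
    unfolding slice_order_def using eq
    by (intro arg_cong[of _ _ concat] map_cong filter_cong refl) auto
  then have "concat (map (slice u) [0..<Suc k]) \<in> L"
    using lab(4) concat_slices[of u k] fst len by simp
  ultimately show ?rhs
    using lab(2,3) fst threads_ordered_cong[of \<sigma> "label u" lab, OF eq]
      same_sources_cong[of \<sigma> "label u" lab, OF eq]
    by (intro bexI[of _ u]) auto
next
  assume ?rhs
  then obtain u where u: "u \<in> lists (A \<times> {..k})" "map fst u = \<sigma>"
    "threads_ordered (map fst u) (label u)" "\<forall>x. same_sources (map fst u) (label u) x"
    "concat (map (slice u) [0..<Suc k]) \<in> L"
    by blast
  have "\<forall>p<length \<sigma>. label u p \<le> k"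
  proof (intro allI impI)
    fix p assume "p < length \<sigma>"
    then have "u ! p \<in> set u" using u(2) by auto
    then show "label u p \<le> k" using u(1) by auto
  qed
  then have "sliced_reordering k \<sigma> (concat (map (slice u) [0..<Suc k]))"
    unfolding sliced_reordering_iff concat_slices[symmetric] using u by auto
  then show "predictive_membership L k \<sigma>"
    unfolding predictive_membership_def using u(5) by blast
qed

theorem corollary7p5:
  fixes \<T> :: "'t set" and \<X> :: "'x set"
    and L :: "('t, 'x) run set" and k :: nat
  assumes "finite \<T>" and "finite \<X>"
    and "regular_language (alphabet \<T> \<X>) L"
    and "k \<ge> 1"
  shows "solvable_in_constant_space_and_linear_time (alphabet \<T> \<X>)
           (predictive_membership L k)"
proof -
  let ?A = "alphabet \<T> \<X>"
  let ?B = "?A \<times> {..k}"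
  \<comment> \<open>Quantification is restricted to the finite sets \<open>\<T>\<close> and
    \<open>\<X>\<close>, as closure under finite conjunctions requires.\<close>
  define U where "U = {u \<in> lists ?B. (\<forall>t\<in>\<T>. thread_ordered t u) \<and>
    (\<forall>x\<in>\<X>. same_sources (map fst u) (label u) x) \<and> concat (map (slice u) [0..<Suc k]) \<in> L}"
  have "regular_language ?B U"
    unfolding U_def
    by (intro regular_conj regular_ball regular_thread_ordered regular_same_sources
        regular_concat_slices assms)
  then have "regular_language ?A (map fst ` U)"
    by (rule regular_projection)
  moreover have "\<sigma> \<in> map fst ` U \<longleftrightarrow> predictive_membership L k \<sigma>" if \<sigma>: "\<sigma> \<in> lists ?A" for \<sigma>
  proof -
    \<comment> \<open>All letters come from the alphabet: a thread outside \<open>\<T>\<close> has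
      no events and a location outside \<open>\<X>\<close> has no reads, so the restricted
      quantifiers lose nothing.\<close>
    have threads: "threads_ordered (map fst u) (label u) \<longleftrightarrow> (\<forall>t\<in>\<T>. thread_ordered t u)"
      and sources: "(\<forall>x. same_sources (map fst u) (label u) x) \<longleftrightarrow>
        (\<forall>x\<in>\<X>. same_sources (map fst u) (label u) x)" if u: "u \<in> lists ?B" for u
    proof -
      have letter: "fst (u ! p) \<in> ?A" if "p < length u" for p
        using u nth_mem[OF that] by (auto simp: in_lists_conv_set mem_Times_iff)
      have "fst (fst (u ! p)) \<in> \<T>" if "p < length u" for p
        using letter[OF that] by (auto simp: alphabet_def)
      then show "threads_ordered (map fst u) (label u) \<longleftrightarrow> (\<forall>t\<in>\<T>. thread_ordered t u)"
        unfolding threads_ordered_def thread_ordered_def by fastforce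
      have "x \<in> \<X>" if "p < length u" "snd (fst (u ! p)) = Read x" for p x
        using letter[OF that(1)] that(2) by (auto simp: alphabet_def)
      then show "(\<forall>x. same_sources (map fst u) (label u) x) \<longleftrightarrow>
        (\<forall>x\<in>\<X>. same_sources (map fst u) (label u) x)"
        unfolding same_sources_def by auto
    qed
    show ?thesis
      unfolding predictive_membership_iff[OF \<sigma>] U_def using threads sources by blast
  qed
  ultimately show ?thesis
    by (rule regular_imp_solvable)
qed

end
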